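(* Let $\theta_1\in(-\pi/2,0)$ (i.e. $\theta_1<0$ lies in the fourth quadrant) and let $$A=\begin{bmatrix}1&\cos\theta_1\\0&\sin\theta_1\end{bmatrix}.$$ Let $X_1,X_2,X_3,\dots$ be $2\times 2$ real matrices such that $X_1$ is an eigenvector matrix of $A$, $X_{i}$ is an eigenvector matrix of $X_{i-1}$ for every $i\ge 2$, and every $X_i$ is of the form $$X_i=\begin{bmatrix}1&\cos\beta_i\\0&\sin\beta_i\end{bmatrix}\qquad\text{with }\beta_i\in(-\pi/2,0)$$ (i.e. the angle of the second column is kept in the fourth quadrant for all eigenvector matrices). Then $$\lim_{i\to\infty}X_i=\begin{bmatrix}1&0\\0&-1\end{bmatrix}.$$
   Context: An eigenvector matrix of an $n\times n$ matrix $M$ is an invertible $n\times n$ matrix $X$ whose columns are eigenvectors of $M$, each of unit Euclidean ($\mathcal L_2$) norm. Equivalently, $MX=X\Lambda$ for some diagonal matrix $\Lambda$, with $X$ invertible and having unit-norm columns. *)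

theory Defs
  imports "HOL-Analysis.Analysis"
begin

definition eigenvector :: "real^'n^'n \<Rightarrow> real^'n \<Rightarrow> bool" where
  "eigenvector M v \<longleftrightarrow> v \<noteq> 0 \<and> (\<exists>c. M *v v = c *\<^sub>R v)"

definition eigenvector_matrix :: "real^'n^'n \<Rightarrow> real^'n^'n \<Rightarrow> bool" where
  "eigenvector_matrix M X \<longleftrightarrow>
     invertible X \<and> (\<forall>j. eigenvector M (column j X) \<and> norm (column j X) = 1)"

text \<open>The matrix is given by its rows.\<close>

definition angle_matrix :: "real \<Rightarrow> real^2^2" where
  "angle_matrix \<theta> = vector [vector [1, cos \<theta>], vector [0, sin \<theta>]]"

end

theory Submission
  imports Defs
begin

text \<open>
  The unit eigenvector \<open>(cos \<beta>, sin \<beta>)\<close> of the matrix with angle \<open>\<theta>\<close> must belong to the eigenvalue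
  \<open>sin \<theta>\<close>, which amounts to \<open>sin (\<beta> - \<theta>) = - cos \<beta> = sin (- \<pi>/2 - \<beta>)\<close>. In the fourth quadrant this
  forces \<open>\<beta> + \<pi>/2 = (\<theta> + \<pi>/2) / 2\<close>, so the distance of the angle to \<open>-\<pi>/2\<close> is halved at each step.
\<close>

lemma eigenvector_matrix_angle_matrix:
  fixes \<theta> \<beta> :: real
  assumes "\<theta> \<in> {- (pi / 2)<..<0}" and "\<beta> \<in> {- (pi / 2)<..<0}"
    and "eigenvector_matrix (angle_matrix \<theta>) (angle_matrix \<beta>)"
  shows "\<beta> + pi / 2 = (\<theta> + pi / 2) / 2"
proof -
  have "eigenvector (angle_matrix \<theta>) (column 2 (angle_matrix \<beta>))"
    using assms(3) by (simp add: eigenvector_matrix_def)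
  then obtain c where
    "angle_matrix \<theta> *v column 2 (angle_matrix \<beta>) = c *\<^sub>R column 2 (angle_matrix \<beta>)"
    by (auto simp: eigenvector_def)
  then have c: "cos \<beta> + cos \<theta> * sin \<beta> = c * cos \<beta>" "sin \<theta> * sin \<beta> = c * sin \<beta>"
    by (simp_all add: vec_eq_iff forall_2 angle_matrix_def column_def matrix_vector_mult_def sum_2)
  \<comment> \<open>A nonzero second coordinate excludes the eigenvalue 1, whose eigenvectors lie on
    the first axis.\<close>
  have "sin \<beta> < 0"
    using assms(2) sin_gt_zero[of "- \<beta>"] by simp
  with c(2) have "c = sin \<theta>" by simp
  with c(1) have "sin (\<beta> - \<theta>) = sin (- (pi / 2) - \<beta>)"
    by (simp add: sin_diff algebra_simps)
  \<comment> \<open>Both arguments lie strictly between -pi/2 and pi/2, where sine is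
    injective.\<close>
  with assms(1,2) have "\<beta> - \<theta> = - (pi / 2) - \<beta>"
    by - (rule sin_inj_pi, auto)
  then show ?thesis by (simp add: field_simps)
qed

text \<open>The angle is unrestricted so that the limit can be taken at -pi/2, just outside the open
  quadrant.\<close>

lemma tendsto_angle_matrix:
  assumes "(f \<longlongrightarrow> \<theta>) F"
  shows "((\<lambda>x. angle_matrix (f x)) \<longlongrightarrow> angle_matrix \<theta>) F"
proof (rule vec_tendstoI)+
  fix i j :: 2
  show "((\<lambda>x. angle_matrix (f x) $ i $ j) \<longlongrightarrow> angle_matrix \<theta> $ i $ j) F"
    using exhaust_2[of i] exhaust_2[of j] isCont_tendsto_compose[OF isCont_cos assms]
      isCont_tendsto_compose[OF isCont_sin assms]
    by (auto simp: angle_matrix_def)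
qed

theorem theorem3p1:
  fixes \<theta>\<^sub>1 :: real and A :: "real^2^2" and X :: "nat \<Rightarrow> real^2^2"
  assumes "\<theta>\<^sub>1 \<in> {- (pi / 2)<..<0}"
    and "A = angle_matrix \<theta>\<^sub>1"
    and "eigenvector_matrix A (X 1)"
    and "\<And>i. i \<ge> 2 \<Longrightarrow> eigenvector_matrix (X (i - 1)) (X i)"
    and "\<And>i. i \<ge> 1 \<Longrightarrow> \<exists>\<beta>\<in>{- (pi / 2)<..<0}. X i = angle_matrix \<beta>"
  shows "X \<longlonglongrightarrow> vector [vector [1, 0], vector [0, -1]]"
proof -
  \<comment> \<open>\<open>X 0\<close> is arbitrary, so \<open>b n\<close> is the angle of
    \<open>X (Suc n)\<close>.\<close>
  have "\<exists>b. \<forall>n. b n \<in> {- (pi / 2)<..<0} \<and> X (Suc n) = angle_matrix (b n)"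
    by (rule choice) (use assms(5) in fastforce)
  then obtain b where b: "\<And>n. b n \<in> {- (pi / 2)<..<0}" "\<And>n. X (Suc n) = angle_matrix (b n)"
    by blast
  have halve: "b (Suc n) + pi / 2 = (b n + pi / 2) / 2" for n
    using assms(4)[of "Suc (Suc n)"] b by (intro eigenvector_matrix_angle_matrix) auto
  have "b n = (b 0 + pi / 2) * (1 / 2) ^ n - pi / 2" for n
  proof (induction n)
    case (Suc n)
    with halve[of n] show ?case by (simp add: field_simps)
  qed simp
  then have b_eq: "b = (\<lambda>n. (b 0 + pi / 2) * (1 / 2) ^ n - pi / 2)"
    by (rule ext)
  have "(\<lambda>n. (b 0 + pi / 2) * (1 / 2) ^ n - pi / 2) \<longlonglongrightarrow> (b 0 + pi / 2) * 0 - pi / 2"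
    by (intro tendsto_intros LIMSEQ_power_zero) simp
  then have "b \<longlonglongrightarrow> - (pi / 2)"
    by (subst b_eq) simp
  then have "(\<lambda>n. X (Suc n)) \<longlonglongrightarrow> angle_matrix (- (pi / 2))"
    unfolding b(2) by (rule tendsto_angle_matrix)
  \<comment> \<open>Undo the index shift; the limit has entries cos(-pi/2) = 0 and sin(-pi/2) =
    -1.\<close>
  then show ?thesis
    by (simp add: filterlim_sequentially_Suc angle_matrix_def)
qed

end
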